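(* Let $D$ be a dendron. Every monotone (not necessarily continuous) function $f:D\to\mathbb{R}$ is fragmented, and it is of Baire class 1 when $D$ is a dendrite. It follows that $M(D)\subset\mathcal{F}(D)$, where $M(D)$ is the set of monotone functions $D\to\mathbb{R}$ and $\mathcal{F}(D)$ is the set of fragmented functions $D\to\mathbb{R}$.
   Context: A continuum is a compact connected Hausdorff space. A continuum $D$ is a dendron if every pair of distinct points $u,v\in D$ can be separated by a third point $w$, i.e. $D\setminus\{w\}=U\cup V$ with $U,V$ disjoint open, $u\in U$, $v\in V$. A dendrite is a metrizable dendron. A (not necessarily continuous) function $f:D\to\mathbb{R}$ is monotone if $f^{-1}(A)$ is connected for every connected $A\subset\mathbb{R}$. Equivalently (on dendrons), $f$ preserves betweenness: whenever $w\in\{u,v\}$ or $w$ separates $u$ from $v$ in $D$, the value $f(w)$ lies in the closed interval with endpoints $f(u),f(v)$. A function $f:X\to\mathbb{R}$ on a compact Hausdorff space $X$ is fragmented if and only if for every nonempty closed $Y\subseteq X$ the restriction $f|_Y:Y\to\mathbb{R}$ has a point of continuity. A function is of Baire class 1 if the preimage of every open set is an $F_\sigma$ set. *)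

theory Defs
  imports "HOL-Analysis.Analysis"
begin

definition continuum :: "'a topology \<Rightarrow> bool" where
  "continuum D \<longleftrightarrow> compact_space D \<and> connected_space D \<and> Hausdorff_space D"

text \<open>In a Hausdorff space the complement of a point is open, so \<open>U\<close> and \<open>V\<close> being open
  in \<open>D\<close> is the same as being open in \<open>D - {w}\<close>. The equation forces \<open>w \<noteq> u\<close> and \<open>w \<noteq> v\<close>.\<close>

definition separates_points :: "'a topology \<Rightarrow> 'a \<Rightarrow> 'a \<Rightarrow> 'a \<Rightarrow> bool" where
  "separates_points D w u v \<longleftrightarrow>
     (\<exists>U V. openin D U \<and> openin D V \<and> U \<inter> V = {} \<and>
            topspace D - {w} = U \<union> V \<and> u \<in> U \<and> v \<in> V)"

definition dendron :: "'a topology \<Rightarrow> bool" where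
  "dendron D \<longleftrightarrow> continuum D \<and>
     (\<forall>u\<in>topspace D. \<forall>v\<in>topspace D. u \<noteq> v \<longrightarrow>
        (\<exists>w\<in>topspace D. separates_points D w u v))"

definition dendrite :: "'a topology \<Rightarrow> bool" where
  "dendrite D \<longleftrightarrow> dendron D \<and> metrizable_space D"

text \<open>Not to be confused with the library's \<open>monotone_map\<close>, which only asks for
  connected preimages of points.\<close>

definition monotone_fun :: "'a topology \<Rightarrow> ('a \<Rightarrow> real) \<Rightarrow> bool" where
  "monotone_fun D f \<longleftrightarrow>
     (\<forall>A. connected A \<longrightarrow> connectedin D {x \<in> topspace D. f x \<in> A})"

text \<open>Stated through points of continuity of restrictions to closed sets; this is the
  appropriate notion for compact Hausdorff spaces.\<close>

definition fragmented_fun :: "'a topology \<Rightarrow> ('a \<Rightarrow> real) \<Rightarrow> bool" where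
  "fragmented_fun D f \<longleftrightarrow>
     (\<forall>Y. closedin D Y \<and> Y \<noteq> {} \<longrightarrow>
        (\<exists>y\<in>Y. topcontinuous_at (subtopology D Y) euclideanreal f y))"

definition baire_one_fun :: "'a topology \<Rightarrow> ('a \<Rightarrow> real) \<Rightarrow> bool" where
  "baire_one_fun D f \<longleftrightarrow>
     (\<forall>U. open U \<longrightarrow> fsigma_in D {x \<in> topspace D. f x \<in> U})"

text \<open>Functions on the carrier of \<open>D\<close> are represented by functions that are
  \<open>undefined\<close> outside of it.\<close>

definition monotone_funs :: "'a topology \<Rightarrow> ('a \<Rightarrow> real) set" where
  "monotone_funs D = {f \<in> extensional (topspace D). monotone_fun D f}"

definition fragmented_funs :: "'a topology \<Rightarrow> ('a \<Rightarrow> real) set" where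
  "fragmented_funs D = {f \<in> extensional (topspace D). fragmented_fun D f}"

end

theory Submission
  imports Defs
begin

text \<open>For \<open>a < b\<close> the sets \<open>{f \<le> a}\<close> and \<open>{f \<ge> b}\<close> are disjoint and connected, so no point
  separates two points of the intersection of their closures: it would have to lie in both sets.
  In a dendron that intersection is therefore at most a singleton. Every discontinuity of \<open>f\<close>
  lies in such an intersection with \<open>a\<close> and \<open>b\<close> rational, so \<open>f\<close> has only countably many
  discontinuities. A nonempty closed set consisting of discontinuities of \<open>f\<close> is thus countable
  and has an isolated point by Baire's theorem, which yields fragmentedness. In the metrizable
  case a preimage of an open set is its interior together with countably many points, hence an
  \<open>F\<^sub>\<sigma>\<close> set.\<close>

text \<open>If \<open>w\<close> were outside \<open>A\<close>, the two open pieces of the complement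
  of \<open>w\<close> would cover \<open>A\<close>. Each is a neighbourhood of a closure point of
  \<open>A\<close>, so each meets \<open>A\<close>, contradicting connectedness.\<close>

lemma connectedin_contains_separating_point:
  assumes "connectedin D A" "separates_points D w u v"
    and "u \<in> D closure_of A" "v \<in> D closure_of A"
  shows "w \<in> A"
proof (rule ccontr)
  assume "w \<notin> A"
  obtain U V where UV: "openin D U" "openin D V" "U \<inter> V = {}"
      "topspace D - {w} = U \<union> V" "u \<in> U" "v \<in> V"
    using assms(2) unfolding separates_points_def by blast
  have "U \<inter> A \<noteq> {}" "V \<inter> A \<noteq> {}"
    using UV assms(3,4) unfolding in_closure_of by blast+
  moreover have "A \<subseteq> U \<union> V"
    using \<open>w \<notin> A\<close> connectedin_subset_topspace[OF assms(1)] UV(4) by blast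
  ultimately show False
    using connectedinD[OF assms(1) UV(1,2)] UV(3) by blast
qed

lemma dendron_closures_meet_at_most_once:
  assumes "dendron D" "connectedin D A" "connectedin D B" "A \<inter> B = {}"
    and "u \<in> D closure_of A \<inter> D closure_of B" "v \<in> D closure_of A \<inter> D closure_of B"
  shows "u = v"
proof (rule ccontr)
  assume "u \<noteq> v"
  moreover have "u \<in> topspace D" "v \<in> topspace D"
    using assms(5,6) by (auto simp: in_closure_of)
  ultimately obtain w where "separates_points D w u v"
    using assms(1) unfolding dendron_def by blast
  then have "w \<in> A \<inter> B"
    using assms by (auto intro: connectedin_contains_separating_point)
  then show False
    using assms(4) by blast
qed

text \<open>Near \<open>x\<close> there are values at distance at least some \<open>e\<close> from
  \<open>f x\<close>, so \<open>x\<close> is a limit of points with values far below or far above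
  \<open>f x\<close>. On the other side \<open>x\<close> itself is the witness. Rational bounds
  leave only countably many pairs.\<close>

lemma not_topcontinuous_at_real:
  assumes "x \<in> topspace X" "\<not> topcontinuous_at X euclideanreal f x"
  obtains a b :: rat where "a < b"
    "x \<in> X closure_of {y \<in> topspace X. f y \<le> of_rat a}"
    "x \<in> X closure_of {y \<in> topspace X. f y \<ge> of_rat b}"
proof -
  obtain V where V: "open V" "f x \<in> V"
    and no_nhd: "\<And>U. openin X U \<Longrightarrow> x \<in> U \<Longrightarrow> \<exists>y\<in>U. f y \<notin> V"
    using assms by (auto simp: topcontinuous_at_def)
  obtain e where "e > 0" and e: "\<And>t. \<bar>t - f x\<bar> < e \<Longrightarrow> t \<in> V"
    using V by (auto simp: open_dist dist_real_def)
  let ?L = "\<lambda>c. {y \<in> topspace X. f y \<le> c}" and ?G = "\<lambda>c. {y \<in> topspace X. f y \<ge> c}"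
  have "x \<in> X closure_of (?L (f x - e) \<union> ?G (f x + e))"
    unfolding in_closure_of
  proof (intro conjI allI impI)
    fix U assume U: "x \<in> U \<and> openin X U"
    then obtain y where "y \<in> U" "f y \<notin> V"
      using no_nhd by blast
    moreover from this have "\<not> \<bar>f y - f x\<bar> < e"
      using e by blast
    moreover have "y \<in> topspace X"
      using U \<open>y \<in> U\<close> openin_subset by blast
    ultimately show "\<exists>y. y \<in> ?L (f x - e) \<union> ?G (f x + e) \<and> y \<in> U"
      by (intro exI[of _ y]) auto
  qed (fact assms(1))
  \<comment> \<open>Closure commutes with finite unions, so one of the two sides already accumulates
    at \<open>x\<close>.\<close>
  then consider "x \<in> X closure_of ?L (f x - e)" | "x \<in> X closure_of ?G (f x + e)"
    by auto
  then show thesis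
  proof cases
    case 1
    \<comment> \<open>Both rationals are chosen in the gap between \<open>f x - e\<close> and
      \<open>f x\<close>: the lower set then contains \<open>?L (f x - e)\<close>, and the upper one
      contains \<open>x\<close>.\<close>
    obtain a where a: "f x - e < of_rat a" "of_rat a < f x"
      using of_rat_dense[of "f x - e" "f x"] \<open>e > 0\<close> by auto
    obtain b where b: "of_rat a < (of_rat b :: real)" "of_rat b < f x"
      using of_rat_dense[OF a(2)] by auto
    have "x \<in> X closure_of ?L (of_rat a)"
      by (rule subsetD[OF closure_of_mono 1]) (use a in auto)
    moreover have "x \<in> X closure_of ?G (of_rat b)"
      by (rule subsetD[OF closure_of_subset]) (use b assms(1) in auto)
    ultimately show thesis
      using that b(1) by (simp add: of_rat_less)
  next
    case 2
    obtain b where b: "f x < of_rat b" "of_rat b < f x + e"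
      using of_rat_dense[of "f x" "f x + e"] \<open>e > 0\<close> by auto
    obtain a where a: "f x < of_rat a" "of_rat a < (of_rat b :: real)"
      using of_rat_dense[OF b(1)] by auto
    have "x \<in> X closure_of ?G (of_rat b)"
      by (rule subsetD[OF closure_of_mono 2]) (use b in auto)
    moreover have "x \<in> X closure_of ?L (of_rat a)"
      by (rule subsetD[OF closure_of_subset]) (use a assms(1) in auto)
    ultimately show thesis
      using that a(2) by (simp add: of_rat_less)
  qed
qed

lemma monotone_fun_countable_discontinuities:
  assumes "dendron D" "monotone_fun D f"
  shows "countable {x \<in> topspace D. \<not> topcontinuous_at D euclideanreal f x}"
proof -
  define M where "M = (\<lambda>(a :: rat, b :: rat).
    D closure_of {y \<in> topspace D. f y \<le> of_rat a} \<inter>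
    D closure_of {y \<in> topspace D. f y \<ge> of_rat b})"
  have "countable (M (a, b))" if "a < b" for a b
  proof -
    \<comment> \<open>The sublevel and superlevel sets are preimages of rays, which are
      connected.\<close>
    have "connectedin D {y \<in> topspace D. f y \<in> {..of_rat a}}"
      "connectedin D {y \<in> topspace D. f y \<in> {of_rat b..}}"
      using assms(2) unfolding monotone_fun_def by (metis connected_Iic, metis connected_Ici)
    moreover have "(of_rat a :: real) < of_rat b"
      using that by (simp add: of_rat_less)
    ultimately have "u = v" if "u \<in> M (a, b)" "v \<in> M (a, b)" for u v
      using that unfolding M_def
      by (intro dendron_closures_meet_at_most_once[OF assms(1)]) auto
    then obtain u where "M (a, b) \<subseteq> {u}"
      by blast
    then show ?thesis
      by (rule countable_subset) simp
  qed
  then have "countable (\<Union>p\<in>{(a, b). a < b}. M p)"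
    by (intro countable_UN) auto
  moreover have "{x \<in> topspace D. \<not> topcontinuous_at D euclideanreal f x}
      \<subseteq> (\<Union>p\<in>{(a, b). a < b}. M p)"
  proof
    fix x assume "x \<in> {x \<in> topspace D. \<not> topcontinuous_at D euclideanreal f x}"
    then have "x \<in> topspace D" "\<not> topcontinuous_at D euclideanreal f x"
      by auto
    then obtain a b :: rat where "a < b" "x \<in> M (a, b)"
      unfolding M_def prod.case by (rule not_topcontinuous_at_real) blast
    then show "x \<in> (\<Union>p\<in>{(a, b). a < b}. M p)"
      by auto
  qed
  ultimately show ?thesis
    by (rule countable_subset[rotated])
qed

lemma topcontinuous_at_subtopology:
  assumes "topcontinuous_at X Y f x" "x \<in> S"
  shows "topcontinuous_at (subtopology X S) Y f x"
  unfolding topcontinuous_at_def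
proof (intro conjI allI impI)
  fix V assume "openin Y V \<and> f x \<in> V"
  then obtain U where "openin X U" "x \<in> U" "\<forall>y\<in>U. f y \<in> V"
    using assms(1) unfolding topcontinuous_at_def by blast
  then show "\<exists>U. openin (subtopology X S) U \<and> x \<in> U \<and> (\<forall>y\<in>U. f y \<in> V)"
    using assms(2) by (intro exI[of _ "S \<inter> U"]) (auto simp: openin_subtopology_Int2)
qed (use assms in \<open>auto simp: topcontinuous_at_def\<close>)

lemma topcontinuous_at_isolated_point:
  assumes "openin X {x}" "f \<in> topspace X \<rightarrow> topspace Y"
  shows "topcontinuous_at X Y f x"
  using assms openin_subset[OF assms(1)] unfolding topcontinuous_at_def by blast

text \<open>Without isolated points every singleton would be closed with empty interior. By Baire
  their countable union would have empty interior too, but this union is the whole nonempty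
  space.\<close>

lemma countable_compact_Hausdorff_isolated_point:
  assumes "compact_space X" "Hausdorff_space X" "countable (topspace X)" "topspace X \<noteq> {}"
  obtains x where "openin X {x}"
proof (rule ccontr)
  assume "\<not> thesis"
  then have no_isolated: "\<not> openin X {x}" for x
    using that by blast
  have "X interior_of {x} = {}" for x
    using no_isolated[of x] interior_of_subset[of X "{x}"] openin_interior_of[of X "{x}"]
    by (metis subset_singletonD)
  moreover have "closedin X {x}" if "x \<in> topspace X" for x
    using that assms(2) by (simp add: closedin_Hausdorff_singleton)
  ultimately have "X interior_of \<Union>((\<lambda>x. {x}) ` topspace X) = {}"
    using assms(1-3)
    by (intro Baire_category_alt)
      (auto simp: compact_imp_locally_compact_space compact_Hausdorff_imp_regular_space)
  then show False
    using assms(4) by simp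
qed

lemma countable_discontinuities_imp_fragmented:
  assumes "compact_space D" "Hausdorff_space D"
    and "countable {x \<in> topspace D. \<not> topcontinuous_at D euclideanreal f x}"
  shows "fragmented_fun D f"
  unfolding fragmented_fun_def
proof (intro allI impI, elim conjE)
  fix Y assume Y: "closedin D Y" "Y \<noteq> {}"
  then have "Y \<subseteq> topspace D"
    by (simp add: closedin_subset)
  show "\<exists>y\<in>Y. topcontinuous_at (subtopology D Y) euclideanreal f y"
  \<comment> \<open>A continuity point of \<open>f\<close> lying in \<open>Y\<close> survives
    restriction. Otherwise \<open>Y\<close> consists of discontinuities, and any function is
    continuous at an isolated point of \<open>Y\<close>.\<close>
  proof (cases "\<exists>y\<in>Y. topcontinuous_at D euclideanreal f y")
    case True
    then obtain y where "y \<in> Y" "topcontinuous_at D euclideanreal f y"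
      by blast
    then show ?thesis
      by (intro bexI[of _ y] topcontinuous_at_subtopology)
  next
    case False
    then have "countable Y"
      using \<open>Y \<subseteq> topspace D\<close> by (intro countable_subset[OF _ assms(3)]) auto
    moreover have "compact_space (subtopology D Y)"
      using Y(1) assms(1) by (simp add: closedin_compact_space compact_space_subtopology)
    ultimately obtain y where y: "openin (subtopology D Y) {y}"
      using countable_compact_Hausdorff_isolated_point[of "subtopology D Y"]
        Hausdorff_space_subtopology[OF assms(2)] \<open>Y \<subseteq> topspace D\<close> Y(2)
      by (metis topspace_subtopology_subset)
    then have "topcontinuous_at (subtopology D Y) euclideanreal f y"
      by (simp add: topcontinuous_at_isolated_point)
    then show ?thesis
      using openin_subset[OF y] by auto
  qed
qed

lemma countable_discontinuities_imp_baire_one: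
  assumes "metrizable_space D"
    and "countable {x \<in> topspace D. \<not> topcontinuous_at D euclideanreal f x}"
  shows "baire_one_fun D f"
  unfolding baire_one_fun_def
proof (intro allI impI)
  fix U :: "real set" assume "open U"
  define P where "P = {x \<in> topspace D. f x \<in> U}"
  define C where "C = P - D interior_of P"
  \<comment> \<open>\<open>U\<close> is a neighbourhood of \<open>f x\<close>, so continuity at
    \<open>x\<close> makes \<open>P\<close> a neighbourhood of \<open>x\<close>. Hence
    \<open>C\<close> contains only discontinuities.\<close>
  have "x \<in> D interior_of P" if x: "x \<in> P" "topcontinuous_at D euclideanreal f x" for x
  proof -
    obtain W where "openin D W" "x \<in> W" "\<forall>y\<in>W. f y \<in> U"
      using x \<open>open U\<close> by (auto simp: topcontinuous_at_def P_def)
    moreover from this have "W \<subseteq> P"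
      using openin_subset unfolding P_def by blast
    ultimately show ?thesis
      by (auto simp: interior_of_def)
  qed
  then have "countable C"
    by (intro countable_subset[OF _ assms(2)]) (auto simp: C_def P_def)
  moreover have "closedin D {x}" if "x \<in> C" for x
    using that metrizable_imp_Hausdorff_space[OF assms(1)]
    by (auto intro: closedin_Hausdorff_singleton simp: C_def P_def)
  ultimately have "fsigma_in D (\<Union>x\<in>C. {x})"
    by (intro fsigma_in_Union) (auto intro: closed_imp_fsigma_in)
  moreover have "fsigma_in D (D interior_of P)"
    using assms(1) by (simp add: open_imp_fsigma_in)
  moreover have "P = D interior_of P \<union> (\<Union>x\<in>C. {x})"
    using interior_of_subset[of D P] by (auto simp: C_def)
  ultimately show "fsigma_in D {x \<in> topspace D. f x \<in> U}"
    unfolding P_def[symmetric] by (metis fsigma_in_Un)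
qed

theorem theorem3p10:
  fixes D :: "'a topology"
  assumes "dendron D"
  shows "(\<forall>f :: 'a \<Rightarrow> real. monotone_fun D f \<longrightarrow> fragmented_fun D f) \<and>
         (dendrite D \<longrightarrow> (\<forall>f :: 'a \<Rightarrow> real. monotone_fun D f \<longrightarrow> baire_one_fun D f)) \<and>
         monotone_funs D \<subseteq> fragmented_funs D"
proof -
  have "fragmented_fun D f" if "monotone_fun D f" for f :: "'a \<Rightarrow> real"
    using assms monotone_fun_countable_discontinuities[OF assms that]
    by (intro countable_discontinuities_imp_fragmented) (auto simp: dendron_def continuum_def)
  moreover have "baire_one_fun D f" if "dendrite D" "monotone_fun D f" for f :: "'a \<Rightarrow> real"
    using that monotone_fun_countable_discontinuities[OF assms that(2)]
    by (intro countable_discontinuities_imp_baire_one) (auto simp: dendrite_def)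
  ultimately show ?thesis
    by (auto simp: monotone_funs_def fragmented_funs_def)
qed

end
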